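(* Fix an integer $k > 1$. As $n \to \infty$, \[ \mathrm{FFW}_k (n) \sim \frac{(-1)^k}{((k - 1)!)^2}\, n^{k - 1} \log n. \]
   Context: For a positive integer $n$, $\mathcal{D}(n)$ denotes the set of partitions of $n$ into distinct parts; for $\pi \in \mathcal{D}(n)$, $\#(\pi)$ is the number of parts of $\pi$ and $s_k(\pi)$ is the $k$th smallest part of $\pi$, with $s_k(\pi)=0$ if $\pi$ has fewer than $k$ parts. $\mathrm{FFW}_k(n) := \sum_{\pi \in \mathcal{D}(n)} (-1)^{\#(\pi)} s_k(\pi)$. *)

theory Defs
  imports Complex_Main "HOL-Library.Landau_Symbols"
begin

text \<open>A partition into distinct parts has no repeated parts, so it is identified with its
  finite set of (positive) parts.\<close>

definition distinct_partitions :: "nat \<Rightarrow> nat set set" where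
  "distinct_partitions n = {P. finite P \<and> 0 \<notin> P \<and> \<Sum>P = n}"

text \<open>The \<open>k\<close>th smallest part is counted from \<open>k = 1\<close>, whereas list indexing starts at 0.\<close>

definition kth_smallest_part :: "nat \<Rightarrow> nat set \<Rightarrow> nat" where
  "kth_smallest_part k P = (if card P < k then 0 else sorted_list_of_set P ! (k - 1))"

definition FFW :: "nat \<Rightarrow> nat \<Rightarrow> int" where
  "FFW k n = (\<Sum>P\<in>distinct_partitions n. (-1) ^ card P * int (kth_smallest_part k P))"

text \<open>Sums over infinite sets are 0 by convention; the sum above is not of that kind.\<close>

lemma finite_distinct_partitions: "finite (distinct_partitions n)"
proof (rule finite_subset)
  show "distinct_partitions n \<subseteq> Pow {..n}"
    by (auto simp: distinct_partitions_def intro: member_le_sum[of _ _ "\<lambda>x. x"])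
qed simp

end

theory Submission
  imports Defs "HOL-Computational_Algebra.Formal_Power_Series" "HOL-Analysis.Harmonic_Numbers"
    "HOL-Real_Asymp.Real_Asymp"
begin

text \<open>
  Write \<open>e\<^sub>j(m)\<close> for the elementary symmetric polynomial of \<open>X, \<dots>, X\<^sup>m\<close> and \<open>Q\<^sub>m\<close> for the product of
  \<open>1 - X\<^sup>i\<close> over \<open>i > m\<close>. If the \<open>k\<close>th smallest part is \<open>m\<close>, then \<open>k - 1\<close> parts lie below \<open>m\<close>, so the
  generating function of \<open>FFW k\<close> is \<open>(-1)\<^sup>k\<close> times the sum of \<open>m X\<^sup>m e\<^sub>k\<^sub>-\<^sub>1(m - 1) Q\<^sub>m\<close>. The identity
  \<open>e\<^sub>j(m) Q\<^sub>m = e\<^sub>j(\<infinity>) Q\<^sub>m\<^sub>-\<^sub>j\<close> for \<open>m \<ge> j\<close> and Abel summation show that, up to sign, the generating functions of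
  \<open>FFW (j + 1)\<close> and \<open>FFW j\<close> differ by \<open>e\<^sub>j(\<infinity>) (j + D)\<close>, where \<open>D\<close> is the sum of \<open>1 - Q\<^sub>i\<close> over all \<open>i\<close>; a
  telescoping argument identifies \<open>D\<close> with the generating function of the number of divisors.
  Since \<open>e\<^sub>j(\<infinity>)\<close> is the product of \<open>X\<^sup>i / (1 - X\<^sup>i)\<close> over \<open>i \<le> j\<close>, the coefficients of \<open>e\<^sub>j(\<infinity>) D\<close> arise from
  the divisor function by summation over arithmetic progressions; starting from Dirichlet's
  estimate \<open>n ln n + O(n)\<close> they are \<open>n\<^sup>j ln n / (j!)\<^sup>2 + O(n\<^sup>j)\<close>, and everything else is \<open>O(n\<^sup>j)\<close>.
  Infinite products are replaced by products over \<open>i \<le> N\<close>, and series are compared modulo \<open>X\<^sup>M\<close>.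
\<close>

unbundle no vec_syntax
unbundle fps_syntax

subsection \<open>Partitions with parts at most \<open>N\<close>\<close>

definition qelem :: "nat \<Rightarrow> nat \<Rightarrow> real fps" where
  "qelem j N = (\<Sum>P | P \<subseteq> {1..N} \<and> card P = j. fps_X ^ \<Sum>P)"

definition ffw_poly :: "nat \<Rightarrow> nat \<Rightarrow> real fps" where
  "ffw_poly k N =
    (\<Sum>P\<in>Pow {1..N}. fps_const ((-1) ^ card P * real (kth_smallest_part k P)) * fps_X ^ \<Sum>P)"

lemma Pow_Suc_interval:
  "Pow {1..Suc N} = Pow {1..N} \<union> insert (Suc N) ` Pow {1..N}"
  by (simp add: atLeastAtMostSuc_conv Pow_insert)

lemma sum_Pow_Suc_interval:
  fixes f :: "nat set \<Rightarrow> 'a::comm_monoid_add"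
  shows "sum f (Pow {1..Suc N}) = sum f (Pow {1..N}) + (\<Sum>P\<in>Pow {1..N}. f (insert (Suc N) P))"
proof -
  have "inj_on (insert (Suc N)) (Pow {1..N})"
  proof (rule inj_onI)
    fix P Q
    assume "P \<in> Pow {1..N}" "Q \<in> Pow {1..N}" and eq: "insert (Suc N) P = insert (Suc N) Q"
    then have "Suc N \<notin> P" "Suc N \<notin> Q"
      by auto
    with eq show "P = Q"
      by (simp add: insert_ident)
  qed
  then have "sum f (insert (Suc N) ` Pow {1..N}) = (\<Sum>P\<in>Pow {1..N}. f (insert (Suc N) P))"
    by (simp add: sum.reindex)
  moreover have "Pow {1..N} \<inter> insert (Suc N) ` Pow {1..N} = {}"
    by auto
  ultimately show ?thesis
    unfolding Pow_Suc_interval by (subst sum.union_disjoint) auto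
qed

lemma insert_Suc_interval:
  assumes "P \<in> Pow {1..N}"
  shows "card (insert (Suc N) P) = Suc (card P)" and "\<Sum>(insert (Suc N) P) = Suc N + \<Sum>P"
proof -
  have "finite P" "Suc N \<notin> P"
    using assms by (auto intro: finite_subset)
  then show "card (insert (Suc N) P) = Suc (card P)" "\<Sum>(insert (Suc N) P) = Suc N + \<Sum>P"
    by auto
qed

lemma qelem_altdef:
  "qelem j N = (\<Sum>P\<in>Pow {1..N}. if card P = j then fps_X ^ \<Sum>P else 0)"
  unfolding qelem_def by (subst sum.inter_filter [symmetric]) (auto intro!: sum.cong)

lemma qelem_0_right: "qelem j 0 = (if j = 0 then 1 else 0)"
  by (simp add: qelem_altdef)

lemma qelem_0_left: "qelem 0 N = 1"
proof -
  have "{P. P \<subseteq> {1..N} \<and> card P = 0} = {{}}"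
    by (auto dest: finite_subset)
  then show ?thesis
    by (simp add: qelem_def)
qed

lemma qelem_Suc_Suc: "qelem (Suc j) (Suc N) = qelem (Suc j) N + fps_X ^ Suc N * qelem j N"
  unfolding qelem_altdef sum_Pow_Suc_interval sum_distrib_left
  by (intro arg_cong2 [where f = "(+)"] refl sum.cong)
     (simp_all add: insert_Suc_interval del: power_Suc flip: power_add)

text \<open>The new element is the largest, so it has rank \<open>Suc j\<close> exactly when
  \<open>card P = j\<close>. In that case the first summand is the default value 0, which makes the
  additive form correct.\<close>

lemma kth_smallest_part_insert_Suc:
  assumes "P \<in> Pow {1..N}"
  shows "kth_smallest_part (Suc j) (insert (Suc N) P) =
    kth_smallest_part (Suc j) P + (if card P = j then Suc N else 0)"
proof -
  have fin: "finite P" and less: "\<forall>x\<in>P. x < Suc N"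
    using assms by (auto intro: finite_subset)
  have "sorted_list_of_set (set (sorted_list_of_set P @ [Suc N])) = sorted_list_of_set P @ [Suc N]"
    using fin less
    by (intro sorted_list_of_set.idem_if_sorted_distinct) (auto simp: sorted_append less_imp_le)
  then have "sorted_list_of_set (insert (Suc N) P) = sorted_list_of_set P @ [Suc N]"
    using fin by simp
  then show ?thesis
    using insert_Suc_interval(1)[OF assms]
    by (auto simp: kth_smallest_part_def nth_append)
qed

lemma signed_of_nat_fps:
  "(-1) ^ n * of_nat m = (fps_const ((-1) ^ n * of_nat m) :: 'a::comm_ring_1 fps)"
  by (metis fps_const_1_eq_1 fps_const_mult fps_const_neg fps_const_power fps_of_nat)

text \<open>Adjoining \<open>Suc N\<close> flips the sign and shifts by
  \<open>fps_X ^ Suc N\<close>; the correction comes from the sets in which \<open>Suc N\<close>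
  becomes the part of rank \<open>Suc j\<close>.\<close>

lemma ffw_poly_Suc:
  "ffw_poly (Suc j) (Suc N) = (1 - fps_X ^ Suc N) * ffw_poly (Suc j) N
     + (-1) ^ Suc j * of_nat (Suc N) * fps_X ^ Suc N * qelem j N"
proof -
  have "(\<Sum>P\<in>Pow {1..N}. fps_const ((-1) ^ card (insert (Suc N) P) *
            real (kth_smallest_part (Suc j) (insert (Suc N) P))) * fps_X ^ \<Sum>(insert (Suc N) P))
      = - (fps_X ^ Suc N) * ffw_poly (Suc j) N
        + (-1) ^ Suc j * of_nat (Suc N) * fps_X ^ Suc N * qelem j N"
    unfolding ffw_poly_def qelem_altdef sum_distrib_left sum.distrib [symmetric]
  proof (rule sum.cong)
    fix P assume P: "P \<in> Pow {1..N}"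
    have c: "fps_const ((-1) ^ Suc c * real (s + t)) =
        - fps_const ((-1) ^ c * real s) + fps_const ((-1) ^ Suc c * real t)" for c s t
      by (simp add: algebra_simps)
    show "fps_const ((-1) ^ card (insert (Suc N) P) *
            real (kth_smallest_part (Suc j) (insert (Suc N) P))) * fps_X ^ \<Sum>(insert (Suc N) P)
       = - (fps_X ^ Suc N) *
           (fps_const ((-1) ^ card P * real (kth_smallest_part (Suc j) P)) * fps_X ^ \<Sum>P)
         + (-1) ^ Suc j * of_nat (Suc N) * fps_X ^ Suc N *
           (if card P = j then fps_X ^ \<Sum>P else 0)"
      unfolding insert_Suc_interval[OF P] kth_smallest_part_insert_Suc[OF P] c power_add
        signed_of_nat_fps
      by (cases "card P = j") (simp_all add: algebra_simps
          del: power_Suc of_nat_Suc fps_const_neg fps_const_add fps_const_sub fps_const_mult)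
  qed simp
  moreover have "ffw_poly (Suc j) (Suc N) = ffw_poly (Suc j) N +
      (\<Sum>P\<in>Pow {1..N}. fps_const ((-1) ^ card (insert (Suc N) P) *
            real (kth_smallest_part (Suc j) (insert (Suc N) P))) * fps_X ^ \<Sum>(insert (Suc N) P))"
    unfolding ffw_poly_def by (rule sum_Pow_Suc_interval)
  ultimately show ?thesis
    by (simp add: left_diff_distrib del: power_Suc of_nat_Suc)
qed

lemma ffw_poly_0: "ffw_poly (Suc j) 0 = 0"
  by (simp add: ffw_poly_def kth_smallest_part_def)

lemma FFW_eq_nth_ffw_poly:
  assumes "n \<le> N"
  shows "real_of_int (FFW k n) = ffw_poly k N $ n"
proof -
  have "distinct_partitions n = {P \<in> Pow {1..N}. \<Sum>P = n}"
  proof (intro set_eqI iffI)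
    fix P assume P: "P \<in> distinct_partitions n"
    have "x \<in> {1..N}" if "x \<in> P" for x
    proof -
      have "x \<le> \<Sum>P"
        using P that member_le_sum[of x P "\<lambda>x. x"] by (auto simp: distinct_partitions_def)
      moreover have "x \<noteq> 0"
        using P that by (auto simp: distinct_partitions_def intro: gr0I)
      ultimately show ?thesis
        using P assms by (auto simp: distinct_partitions_def)
    qed
    then show "P \<in> {P \<in> Pow {1..N}. \<Sum>P = n}"
      using P by (auto simp: distinct_partitions_def)
  qed (auto simp: distinct_partitions_def intro: finite_subset)
  then have "real_of_int (FFW k n) =
      (\<Sum>P\<in>{P \<in> Pow {1..N}. \<Sum>P = n}. (-1) ^ card P * real (kth_smallest_part k P))"
    by (simp add: FFW_def)
  also have "\<dots> = (\<Sum>P\<in>Pow {1..N}. if \<Sum>P = n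
                     then (-1) ^ card P * real (kth_smallest_part k P) else 0)"
    by (rule sum.inter_filter) simp
  also have "\<dots> = ffw_poly k N $ n"
    by (auto simp: ffw_poly_def fps_sum_nth fps_X_power_nth intro!: sum.cong)
  finally show ?thesis .
qed

subsection \<open>Truncated products\<close>

definition qprod :: "nat \<Rightarrow> nat \<Rightarrow> real fps" where
  "qprod m N = (\<Prod>i\<in>{m<..N}. 1 - fps_X ^ i)"

lemma qprod_self: "qprod N N = 1"
  by (simp add: qprod_def)

lemma greaterThanAtMost_insert_Suc: "m \<le> N \<Longrightarrow> {m<..Suc N} = insert (Suc N) {m<..N}"
  by auto

lemma qprod_Suc_right: "m \<le> N \<Longrightarrow> qprod m (Suc N) = (1 - fps_X ^ Suc N) * qprod m N"
  by (simp add: qprod_def greaterThanAtMost_insert_Suc del: power_Suc)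

lemma qprod_Suc_left: "m < N \<Longrightarrow> qprod m N = (1 - fps_X ^ Suc m) * qprod (Suc m) N"
  unfolding qprod_def atLeastSucAtMost_greaterThanAtMost [symmetric]
  by (simp add: prod.atLeast_Suc_atMost)

text \<open>The expansion of \<open>X\<^sup>r / (1 - X\<^sup>r)\<close>.\<close>

definition qgeom :: "nat \<Rightarrow> real fps" where
  "qgeom r = Abs_fps (\<lambda>n. if 0 < n \<and> r dvd n then 1 else 0)"

lemma one_minus_X_power_mult_qgeom: "0 < r \<Longrightarrow> (1 - fps_X ^ r) * qgeom r = fps_X ^ r"
proof (rule fps_ext)
  fix n
  assume r: "0 < r"
  have "((1 - fps_X ^ r) * qgeom r) $ n = qgeom r $ n - (if n < r then 0 else qgeom r $ (n - r))"
    by (simp add: left_diff_distrib fps_X_power_mult_nth)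
  also have "\<dots> = (fps_X ^ r :: real fps) $ n"
  proof (cases n r rule: linorder_cases)
    case less
    then have "\<not> (0 < n \<and> r dvd n)"
      by (auto dest: dvd_imp_le)
    then show ?thesis
      using less by (auto simp: qgeom_def)
  next
    case equal
    then show ?thesis
      using r by (simp add: qgeom_def)
  next
    case greater
    then have "r dvd n - r \<longleftrightarrow> r dvd n"
      by (simp add: dvd_minus_self)
    then show ?thesis
      using greater r by (simp add: qgeom_def)
  qed
  finally show "((1 - fps_X ^ r) * qgeom r) $ n = (fps_X ^ r :: real fps) $ n" .
qed

text \<open>The limit of \<open>qelem j N\<close> as \<open>N\<close> tends to infinity.\<close>

definition qelem_inf :: "nat \<Rightarrow> real fps" where
  "qelem_inf j = (\<Prod>i=1..j. qgeom i)"

lemma qelem_inf_0: "qelem_inf 0 = 1"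
  by (simp add: qelem_inf_def)

lemma qelem_inf_Suc: "qelem_inf (Suc j) = qgeom (Suc j) * qelem_inf j"
  by (simp add: qelem_inf_def mult.commute)

lemma one_minus_X_power_mult_qelem_inf:
  "(1 - fps_X ^ Suc j) * qelem_inf (Suc j) = fps_X ^ Suc j * qelem_inf j"
  using one_minus_X_power_mult_qgeom[of "Suc j"]
  by (simp add: qelem_inf_Suc flip: mult.assoc del: power_Suc)

lemma one_minus_X_power_nonzero: "0 < r \<Longrightarrow> (1 - fps_X ^ r :: real fps) \<noteq> 0"
proof
  assume "0 < r" and "(1 - fps_X ^ r :: real fps) = 0"
  then have "(1 - fps_X ^ r :: real fps) $ 0 = 0"
    by (simp only: fps_zero_nth)
  with \<open>0 < r\<close> show False
    by simp
qed

text \<open>Up to a power of X, e_j(m) is the Gaussian binomial [m choose j], hence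
  \<open>qelem_inf j\<close> times the product of 1 - X^i over m - j < i <= m; these factors extend
  \<open>qprod m N\<close> downwards. The induction uses the q-Pascal rule
  \<open>qelem_Suc_Suc\<close>.\<close>

lemma qelem_mult_qprod:
  assumes "m \<le> N"
  shows "qelem j m * qprod m N = (if j \<le> m then qelem_inf j * qprod (m - j) N else 0)"
  using assms
proof (induction m arbitrary: j)
  case 0
  then show ?case
    by (simp add: qelem_0_right qelem_inf_0)
next
  case (Suc m)
  note step = Suc.IH Suc.prems
  show ?case
  proof (cases j)
    case 0
    then show ?thesis
      by (simp add: qelem_0_left qelem_inf_0)
  next
    case (Suc i)
    let ?u = "1 - fps_X ^ Suc m :: real fps"
    have Q: "qprod m N = ?u * qprod (Suc m) N"
      using step by (intro qprod_Suc_left) simp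
    have IH: "qelem l m * qprod m N = (if l \<le> m then qelem_inf l * qprod (m - l) N else 0)" for l
      using step by simp
    \<comment> \<open>The factor \<open>?u\<close> turns \<open>qprod (Suc m) N\<close> into
      \<open>qprod m N\<close>, to which the induction hypothesis applies; it is cancelled at the
      end.\<close>
    have "?u * (qelem (Suc i) (Suc m) * qprod (Suc m) N)
        = qelem (Suc i) m * qprod m N + fps_X ^ Suc m * (qelem i m * qprod m N)"
      unfolding qelem_Suc_Suc Q by (simp add: algebra_simps)
    also have "\<dots> = ?u * (if Suc i \<le> Suc m then qelem_inf (Suc i) * qprod (m - i) N else 0)"
    \<comment> \<open>For \<open>i < m\<close> both terms survive and combine through (1 - x) + x (1
      - z) = 1 - x z; for \<open>i = m\<close> only the second is nonzero, for \<open>i > m\<close>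
      neither.\<close>
    proof (cases i m rule: linorder_cases)
      case less
      let ?x = "fps_X ^ (m - i) :: real fps" and ?z = "fps_X ^ Suc i :: real fps"
      have y: "fps_X ^ Suc m = ?x * ?z"
        using less by (simp flip: power_add power_Suc)
      have "qprod (m - Suc i) N = (1 - ?x) * qprod (m - i) N"
        using qprod_Suc_left[of "m - Suc i" N] less step by (simp add: Suc_diff_Suc)
      then have "qelem (Suc i) m * qprod m N = qelem_inf (Suc i) * ((1 - ?x) * qprod (m - i) N)"
        using IH[of "Suc i"] less by (simp only: if_True Suc_le_eq)
      then have "qelem (Suc i) m * qprod m N + fps_X ^ Suc m * (qelem i m * qprod m N)
          = ((1 - ?x) * qelem_inf (Suc i) + ?x * (?z * qelem_inf i)) * qprod (m - i) N"
        using less by (simp add: IH y algebra_simps del: power_Suc)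
      also have "\<dots> = (1 - ?x * ?z) * qelem_inf (Suc i) * qprod (m - i) N"
        unfolding one_minus_X_power_mult_qelem_inf [symmetric] by (simp add: algebra_simps)
      finally show ?thesis
        using less by (simp add: y mult.assoc del: power_Suc)
    next
      case equal
      then show ?thesis
        using one_minus_X_power_mult_qelem_inf[of m]
        by (simp add: IH del: power_Suc flip: mult.assoc)
    next
      case greater
      then show ?thesis by (simp add: IH)
    qed
    finally show ?thesis
      using one_minus_X_power_nonzero[of "Suc m"] Suc by (simp del: power_Suc)
  qed
qed

section \<open>Sums over the value of the part of rank j + 1\<close>

definition qsum :: "nat \<Rightarrow> nat \<Rightarrow> real fps" where
  "qsum j N = (\<Sum>m=1..N. of_nat m * (fps_X ^ m * qelem j (m - 1) * qprod m N))"

lemma qsum_Suc: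
  "qsum j (Suc N) = (1 - fps_X ^ Suc N) * qsum j N + of_nat (Suc N) * fps_X ^ Suc N * qelem j N"
proof -
  have "(\<Sum>m=1..N. of_nat m * (fps_X ^ m * qelem j (m - 1) * qprod m (Suc N)))
      = (1 - fps_X ^ Suc N) * qsum j N"
    unfolding qsum_def sum_distrib_left
    by (rule sum.cong) (simp_all add: qprod_Suc_right mult_ac del: power_Suc)
  then show ?thesis
    by (simp add: qsum_def qprod_self mult_ac del: power_Suc of_nat_Suc)
qed

text \<open>Both sides satisfy the same recursion in \<open>N\<close> and vanish at 0; this avoids a
  bijection splitting each set at its part of rank \<open>Suc j\<close>.\<close>

lemma ffw_poly_eq_qsum: "ffw_poly (Suc j) N = (-1) ^ Suc j * qsum j N"
proof (induction N)
  case 0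
  then show ?case
    by (simp add: ffw_poly_0 qsum_def)
next
  case (Suc N)
  show ?case
    unfolding ffw_poly_Suc qsum_Suc Suc
    by (simp add: algebra_simps del: power_Suc of_nat_Suc)
qed

lemma sum_of_nat_mult_diff:
  fixes a :: "nat \<Rightarrow> 'a::comm_ring_1"
  shows "(\<Sum>m=1..N. of_nat m * (a m - a (m - 1))) = of_nat N * a N - (\<Sum>m<N. a m)"
  by (induction N) (simp_all add: algebra_simps)

lemma qsum_0: "qsum 0 N = of_nat N - (\<Sum>i<N. qprod i N)"
proof -
  have "qsum 0 N = (\<Sum>m=1..N. of_nat m * (qprod m N - qprod (m - 1) N))"
    unfolding qsum_def
  proof (rule sum.cong)
    fix m assume m: "m \<in> {1..N}"
    then have "m - 1 < N"
      by auto
    with m show "of_nat m * (fps_X ^ m * qelem 0 (m - 1) * qprod m N) =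
        of_nat m * (qprod m N - qprod (m - 1) N)"
      using qprod_Suc_left[of "m - 1" N] by (simp add: qelem_0_left left_diff_distrib)
  qed simp
  then show ?thesis
    using sum_of_nat_mult_diff[of "\<lambda>m. qprod m N" N] by (simp add: qprod_self)
qed

text \<open>The recursions for \<open>qelem\<close> and \<open>qprod\<close> turn the summand into a
  difference of consecutive values of \<open>qelem (Suc j) m * qprod m N\<close>, so Abel summation
  applies. \<open>qelem_mult_qprod\<close> then pulls out \<open>qelem_inf (Suc j)\<close> and
  lowers the index by \<open>Suc j\<close>, which is why \<open>N\<close> exceeds \<open>M\<close>
  by that amount.\<close>

lemma qsum_Suc_add_qsum:
  assumes "N = M + Suc j"
  shows "qsum (Suc j) N + qsum j N =
    qelem_inf (Suc j) * (of_nat N * qprod M N - (\<Sum>i<M. qprod i N))"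
proof -
  define a where "a m = qelem (Suc j) m * qprod m N" for m
  have a: "a m = (if Suc j \<le> m then qelem_inf (Suc j) * qprod (m - Suc j) N else 0)"
    if "m \<le> N" for m
    using qelem_mult_qprod[OF that, of "Suc j"] by (simp add: a_def)
  have "qsum (Suc j) N + qsum j N = (\<Sum>m=1..N. of_nat m * (a m - a (m - 1)))"
    unfolding qsum_def sum.distrib [symmetric]
  proof (rule sum.cong)
    fix m assume m: "m \<in> {1..N}"
    then obtain l where l: "m = Suc l"
      by (cases m) auto
    have Q: "qprod l N = (1 - fps_X ^ Suc l) * qprod (Suc l) N"
      using l m by (intro qprod_Suc_left) simp
    have "fps_X ^ m * qelem (Suc j) (m - 1) * qprod m N + fps_X ^ m * qelem j (m - 1) * qprod m N
        = a m - a (m - 1)"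
      unfolding a_def l diff_Suc_1 qelem_Suc_Suc Q
      by (simp add: algebra_simps del: power_Suc)
    then show "of_nat m * (fps_X ^ m * qelem (Suc j) (m - 1) * qprod m N) +
        of_nat m * (fps_X ^ m * qelem j (m - 1) * qprod m N) = of_nat m * (a m - a (m - 1))"
      by (simp flip: distrib_left)
  qed simp
  also have "\<dots> = of_nat N * a N - (\<Sum>m<N. a m)"
    by (rule sum_of_nat_mult_diff)
  also have "(\<Sum>m<N. a m) = (\<Sum>m=Suc j..<N. a m)"
    using a assms by (intro sum.mono_neutral_right) auto
  also have "\<dots> = (\<Sum>i<M. a (i + Suc j))"
    using sum.shift_bounds_nat_ivl[of a 0 "Suc j" M] assms by (simp add: atLeast0LessThan)
  also have "\<dots> = (\<Sum>i<M. qelem_inf (Suc j) * qprod i N)"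
    using assms by (intro sum.cong) (simp_all add: a)
  also have "a N = qelem_inf (Suc j) * qprod M N"
    using assms by (simp add: a)
  finally show ?thesis
    by (simp add: algebra_simps sum_distrib_left)
qed

subsection \<open>Congruences modulo powers of \<open>X\<close>\<close>

lemma fps_X_power_dvd_iff: "fps_X ^ M dvd f \<longleftrightarrow> (\<forall>n<M. f $ n = 0)"
  for f :: "'a::comm_ring_1 fps"
proof
  assume "\<forall>n<M. f $ n = 0"
  then have "f = fps_X ^ M * fps_shift M f"
    by (auto simp: fps_eq_iff fps_X_power_mult_nth)
  then show "fps_X ^ M dvd f"
    by (rule dvdI)
qed (auto simp: dvd_def fps_X_power_mult_nth)

lemma fps_X_power_dvd_qprod_diff_1: "m \<le> N \<Longrightarrow> fps_X ^ Suc m dvd qprod m N - 1"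
proof (induction N rule: dec_induct)
  case base
  then show ?case
    by (simp add: qprod_self)
next
  case (step n)
  have eq: "qprod m (Suc n) - 1 = (qprod m n - 1) - fps_X ^ Suc n * qprod m n"
    using step by (simp add: qprod_Suc_right algebra_simps del: power_Suc)
  show ?case
    unfolding eq
    by (rule dvd_diff[OF step.IH dvd_mult2[OF le_imp_power_dvd]]) (use step in simp)
qed

lemma fps_X_power_dvd_qprod_diff:
  assumes "i \<le> N"
  shows "fps_X ^ Suc N dvd qprod i (N + d) - qprod i N"
proof (induction d)
  case (Suc d)
  have eq: "qprod i (N + Suc d) - qprod i N =
      (qprod i (N + d) - qprod i N) - fps_X ^ Suc (N + d) * qprod i (N + d)"
    using assms by (simp add: qprod_Suc_right algebra_simps del: power_Suc)
  show ?case
    unfolding eq by (rule dvd_diff[OF Suc dvd_mult2[OF le_imp_power_dvd]]) simp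
qed simp

section \<open>Telescoping to the divisor function\<close>

lemma sum_qprod_telescope:
  "(\<Sum>i<M. fps_X ^ i * (1 - fps_X ^ Suc r) * qprod i (i + r)) = (1 - fps_X ^ M) * qprod M (M + r)"
proof (induction M)
  case (Suc M)
  \<comment> \<open>Both sides are \<open>qprod M (Suc M + r)\<close>, with its first or its last
    factor split off.\<close>
  have "(1 - fps_X ^ Suc M) * qprod (Suc M) (Suc M + r) =
      (1 - fps_X ^ Suc (M + r)) * qprod M (M + r)"
    using qprod_Suc_left[of M "Suc M + r"] qprod_Suc_right[of M "M + r"] by simp
  then show ?case
    using Suc by (simp add: algebra_simps power_add)
qed simp

text \<open>The range of \<open>r\<close> makes the constant coefficient 0, although every number
  divides 0.\<close>

definition divisor_fps :: "real fps" where
  "divisor_fps = Abs_fps (\<lambda>n. real (card {r \<in> {1..n}. r dvd n}))"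

text \<open>The Lambert series of the divisor function: terms with \<open>r > N\<close> only affect
  coefficients beyond \<open>N\<close>.\<close>

lemma divisor_fps_eq_sum_qgeom: "fps_X ^ Suc N dvd (\<Sum>r=1..N. qgeom r) - divisor_fps"
  unfolding fps_X_power_dvd_iff
proof (intro allI impI)
  fix n assume n: "n < Suc N"
  have "(\<Sum>r=1..N. qgeom r $ n) = (\<Sum>r\<in>{1..N}. if 0 < n \<and> r dvd n then 1 else 0)"
    by (simp add: qgeom_def)
  also have "\<dots> = real (card {r \<in> {1..N}. 0 < n \<and> r dvd n})"
    by (subst sum.inter_filter [symmetric]) simp_all
  also have "{r \<in> {1..N}. 0 < n \<and> r dvd n} = {r \<in> {1..n}. r dvd n}"
    using n by (auto dest: dvd_imp_le)
  finally show "((\<Sum>r=1..N. qgeom r) - divisor_fps) $ n = 0"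
    by (simp add: fps_sum_nth divisor_fps_def)
qed

lemma fps_X_power_dvd_cancel:
  fixes f :: "real fps"
  assumes "0 < r" and "fps_X ^ M dvd (1 - fps_X ^ r) * f"
  shows "fps_X ^ M dvd f"
proof -
  have "is_unit (1 - fps_X ^ r :: real fps)"
    using assms(1) by simp
  then show ?thesis
    using assms(2) by (simp add: dvd_mult_unit_iff')
qed

text \<open>For windows of fixed length \<open>R\<close>, raising \<open>R\<close> by one changes
  the sum by \<open>fps_X ^ Suc R\<close> times a sum that telescopes after multiplication by
  \<open>1 - fps_X ^ Suc R\<close>. Modulo \<open>fps_X ^ M\<close> this is the equation that
  characterises \<open>qgeom (Suc R)\<close>.\<close>

lemma fps_X_power_dvd_sum_diff_qgeom:
  "fps_X ^ M dvd (\<Sum>i<M. 1 - qprod i (i + R)) - (\<Sum>r=1..R. qgeom r)"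
proof (induction R)
  case 0
  then show ?case
    by (simp add: qprod_self)
next
  case (Suc R)
  let ?S = "\<lambda>R. \<Sum>i<M. 1 - qprod i (i + R)"
  have "?S (Suc R) - ?S R = fps_X ^ Suc R * (\<Sum>i<M. fps_X ^ i * qprod i (i + R))"
    unfolding sum_subtractf [symmetric] sum_distrib_left
    by (rule sum.cong) (simp_all add: qprod_Suc_right algebra_simps power_add)
  then have "(1 - fps_X ^ Suc R) * (?S (Suc R) - ?S R) = fps_X ^ Suc R *
      (\<Sum>i<M. fps_X ^ i * (1 - fps_X ^ Suc R) * qprod i (i + R))"
    by (simp add: sum_distrib_left mult_ac del: power_Suc)
  then have "(1 - fps_X ^ Suc R) * (?S (Suc R) - ?S R - qgeom (Suc R)) =
      fps_X ^ Suc R * ((qprod M (M + R) - 1) - fps_X ^ M * qprod M (M + R))"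
    unfolding sum_qprod_telescope right_diff_distrib[of "1 - fps_X ^ Suc R"]
      one_minus_X_power_mult_qgeom[OF zero_less_Suc]
    by (simp add: algebra_simps del: power_Suc)
  moreover have "fps_X ^ M dvd qprod M (M + R) - 1"
    by (rule power_le_dvd[OF fps_X_power_dvd_qprod_diff_1]) simp_all
  ultimately have "fps_X ^ M dvd (1 - fps_X ^ Suc R) * (?S (Suc R) - ?S R - qgeom (Suc R))"
    by (metis dvd_diff dvd_mult dvd_triv_left)
  then have "fps_X ^ M dvd ?S (Suc R) - ?S R - qgeom (Suc R)"
    by (rule fps_X_power_dvd_cancel[OF zero_less_Suc])
  from dvd_add[OF this Suc] show ?case
    by (simp add: algebra_simps)
qed

text \<open>Windows of length \<open>N\<close> may be cut off at \<open>N\<close>, since the dropped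
  factors are 1 modulo \<open>fps_X ^ Suc N\<close>; the Lambert series then gives the divisor
  function.\<close>

lemma fps_X_power_dvd_sum_qprod:
  assumes "M \<le> N"
  shows "fps_X ^ M dvd (of_nat M - (\<Sum>i<M. qprod i N)) - divisor_fps"
proof -
  have "fps_X ^ M dvd (\<Sum>i<M. qprod i (i + N) - qprod i N)"
  proof (rule dvd_sum)
    fix i assume "i \<in> {..<M}"
    then have "fps_X ^ Suc N dvd qprod i (i + N) - qprod i N"
      using fps_X_power_dvd_qprod_diff[of i N i] assms by (simp add: add.commute)
    then show "fps_X ^ M dvd qprod i (i + N) - qprod i N"
      using assms by (rule power_le_dvd[OF _ le_SucI])
  qed
  moreover have "fps_X ^ M dvd (\<Sum>r=1..N. qgeom r) - divisor_fps"
    using divisor_fps_eq_sum_qgeom assms by (rule power_le_dvd[OF _ le_SucI])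
  moreover note fps_X_power_dvd_sum_diff_qgeom[of M N]
  ultimately have "fps_X ^ M dvd (\<Sum>i<M. qprod i (i + N) - qprod i N) +
      ((\<Sum>r=1..N. qgeom r) - divisor_fps) + ((\<Sum>i<M. 1 - qprod i (i + N)) - (\<Sum>r=1..N. qgeom r))"
    by (intro dvd_add)
  then show ?thesis
    by (simp add: sum_subtractf algebra_simps)
qed

section \<open>The recurrence in k\<close>

lemma nth_qsum_eq_FFW: "n \<le> N \<Longrightarrow> qsum j N $ n = (-1) ^ Suc j * real_of_int (FFW (Suc j) n)"
  by (simp add: FFW_eq_nth_ffw_poly ffw_poly_eq_qsum minus_one_power_iff)

text \<open>The classical identity of Fokkink, Fokkink and Wang, the starting point of the
  recurrence.\<close>

lemma FFW_1: "real_of_int (FFW 1 n) = - (divisor_fps $ n)"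
proof -
  have "fps_X ^ Suc n dvd qsum 0 (Suc n) - divisor_fps"
    unfolding qsum_0 by (rule fps_X_power_dvd_sum_qprod) simp
  then have "qsum 0 (Suc n) $ n = divisor_fps $ n"
    unfolding fps_X_power_dvd_iff by (auto dest: spec[of _ n])
  then show ?thesis
    using nth_qsum_eq_FFW[of n "Suc n" 0] by simp
qed

text \<open>Modulo \<open>fps_X ^ M\<close> the series \<open>qprod M N\<close> is 1, so
  \<open>of_nat N * qprod M N\<close> splits into \<open>of_nat M\<close>, which completes
  \<open>divisor_fps\<close>, and the surplus \<open>of_nat (Suc j)\<close>. The opposite signs
  attached to consecutive \<open>qsum\<close> turn their sum into a difference of \<open>FFW\<close>
  values.\<close>

lemma FFW_recurrence:
  "real_of_int (FFW (Suc (Suc j)) n) = real_of_int (FFW (Suc j) n) +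
     (-1) ^ j * (qelem_inf (Suc j) * (of_nat (Suc j) + divisor_fps)) $ n"
proof -
  define M N where "M = Suc n" and "N = M + Suc j"
  let ?e = "qelem_inf (Suc j)"
  have "fps_X ^ M dvd qprod M N - 1"
    by (rule power_le_dvd[OF fps_X_power_dvd_qprod_diff_1]) (simp_all add: N_def)
  moreover have "fps_X ^ M dvd (of_nat M - (\<Sum>i<M. qprod i N)) - divisor_fps"
    by (rule fps_X_power_dvd_sum_qprod) (simp add: N_def)
  ultimately have "fps_X ^ M dvd ?e * (of_nat N * (qprod M N - 1) +
      ((of_nat M - (\<Sum>i<M. qprod i N)) - divisor_fps))"
    by (intro dvd_mult dvd_add)
  also have "?e * (of_nat N * (qprod M N - 1) +
      ((of_nat M - (\<Sum>i<M. qprod i N)) - divisor_fps)) =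
      qsum (Suc j) N + qsum j N - ?e * (of_nat (Suc j) + divisor_fps)"
    unfolding qsum_Suc_add_qsum[OF N_def] by (simp add: N_def algebra_simps)
  finally have "(qsum (Suc j) N + qsum j N) $ n = (?e * (of_nat (Suc j) + divisor_fps)) $ n"
    unfolding fps_X_power_dvd_iff M_def by (auto dest: spec[of _ n])
  then have "(-1) ^ j * (real_of_int (FFW (Suc (Suc j)) n) - real_of_int (FFW (Suc j) n)) =
      (?e * (of_nat (Suc j) + divisor_fps)) $ n"
    by (simp add: nth_qsum_eq_FFW M_def N_def algebra_simps)
  then have "(-1) ^ j *
        ((-1) ^ j * (real_of_int (FFW (Suc (Suc j)) n) - real_of_int (FFW (Suc j) n))) =
      (-1) ^ j * (?e * (of_nat (Suc j) + divisor_fps)) $ n"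
    by simp
  then show ?thesis
    by (cases "even j") simp_all
qed

subsection \<open>Asymptotics\<close>

text \<open>Multiplication by \<open>qgeom s\<close> sums over n - s, n - 2 s, ...; \<open>n\<close>
  itself is excluded since the constant coefficient of \<open>qgeom s\<close> is 0.\<close>

lemma nth_qgeom_mult: "(qgeom s * f) $ n = (\<Sum>m | m < n \<and> s dvd n - m. f $ m)"
proof -
  have "(qgeom s * f) $ n = (\<Sum>m\<in>{0..n}. if m < n \<and> s dvd n - m then f $ m else 0)"
    unfolding mult.commute[of _ f] fps_mult_nth by (rule sum.cong) (auto simp: qgeom_def)
  also have "\<dots> = (\<Sum>m\<in>{m \<in> {0..n}. m < n \<and> s dvd n - m}. f $ m)"
    by (rule sum.inter_filter [symmetric]) simp
  also have "{m \<in> {0..n}. m < n \<and> s dvd n - m} = {m. m < n \<and> s dvd n - m}"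
    by auto
  finally show ?thesis .
qed

section \<open>Summation over arithmetic progressions\<close>

lemma power_Suc_diff_bounds:
  fixes x y :: real
  assumes "0 \<le> x" "x \<le> y"
  shows "real (Suc r) * x ^ r * (y - x) \<le> y ^ Suc r - x ^ Suc r"
    and "y ^ Suc r - x ^ Suc r \<le> real (Suc r) * y ^ r * (y - x)"
proof -
  have eq: "y ^ Suc r - x ^ Suc r = (y - x) * (\<Sum>p<Suc r. y ^ p * x ^ (r - p))"
    by (rule diff_power_eq_sum)
  have "x ^ r \<le> y ^ p * x ^ (r - p) \<and> y ^ p * x ^ (r - p) \<le> y ^ r" if "p < Suc r" for p
  proof -
    have "x ^ r = x ^ p * x ^ (r - p)" "y ^ r = y ^ p * y ^ (r - p)"
      using that by (simp_all flip: power_add)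
    then show ?thesis
      using assms by (auto intro!: mult_mono power_mono)
  qed
  then have "real (Suc r) * x ^ r \<le> (\<Sum>p<Suc r. y ^ p * x ^ (r - p))"
    "(\<Sum>p<Suc r. y ^ p * x ^ (r - p)) \<le> real (Suc r) * y ^ r"
    using sum_bounded_below[of "{..<Suc r}" "x ^ r"] sum_bounded_above[of "{..<Suc r}" _ "y ^ r"]
    by (simp_all del: sum.lessThan_Suc of_nat_Suc)
  then have "(y - x) * (real (Suc r) * x ^ r) \<le> y ^ Suc r - x ^ Suc r"
    "y ^ Suc r - x ^ Suc r \<le> (y - x) * (real (Suc r) * y ^ r)"
    unfolding eq using assms by (auto intro!: mult_left_mono simp del: sum.lessThan_Suc of_nat_Suc)
  then show "real (Suc r) * x ^ r * (y - x) \<le> y ^ Suc r - x ^ Suc r"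
    "y ^ Suc r - x ^ Suc r \<le> real (Suc r) * y ^ r * (y - x)"
    by (simp_all add: mult_ac)
qed

lemma sum_progression_rec:
  fixes f :: "nat \<Rightarrow> 'a::comm_monoid_add"
  assumes "0 < s" "s \<le> n"
  shows "(\<Sum>m | m < n \<and> s dvd n - m. f m) = f (n - s) + (\<Sum>m | m < n - s \<and> s dvd n - s - m. f m)"
proof -
  have "{m. m < n \<and> s dvd n - m} = insert (n - s) {m. m < n - s \<and> s dvd n - s - m}"
  proof (intro set_eqI iffI)
    fix m assume "m \<in> {m. m < n \<and> s dvd n - m}"
    then have m: "m < n" "s dvd n - m"
      by auto
    then have "s \<le> n - m"
      by (simp add: dvd_imp_le)
    then have "m \<le> n - s"
      using m assms by simp
    moreover have "s dvd n - m - s"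
      using m by (intro dvd_diff_nat[OF _ dvd_refl])
    then have "s dvd n - s - m"
      by (subst diff_commute)
    ultimately show "m \<in> insert (n - s) {m. m < n - s \<and> s dvd n - s - m}"
      by auto
  next
    fix m assume "m \<in> insert (n - s) {m. m < n - s \<and> s dvd n - s - m}"
    then consider "m = n - s" | "m < n - s" "s dvd n - s - m"
      by auto
    then show "m \<in> {m. m < n \<and> s dvd n - m}"
    proof cases
      case 2
      then have eq: "n - m = (n - s - m) + s"
        by simp
      have "s dvd n - m"
        unfolding eq by (intro dvd_add 2(2) dvd_refl)
      with 2(1) show ?thesis
        by simp
    qed (use assms in auto)
  qed
  then show ?thesis
    by simp
qed

lemma sum_progression_less:
  fixes f :: "nat \<Rightarrow> 'a::comm_monoid_add"
  assumes "n < s"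
  shows "(\<Sum>m | m < n \<and> s dvd n - m. f m) = 0"
proof -
  have "{m. m < n \<and> s dvd n - m} = {}"
    using assms by (auto dest!: dvd_imp_le)
  then show ?thesis
    by (simp only: sum.empty)
qed

text \<open>Comparison with an integral: over one step \<open>s\<close> the power
  \<open>x ^ Suc r\<close> grows by at least \<open>K * x ^ r\<close> and at most
  \<open>K * (x + s) ^ r\<close>, where \<open>K = s * Suc r\<close>. The case \<open>r = 0\<close>
  counts the terms of the progression.\<close>

lemma sum_powers_progression:
  assumes "0 < s"
  shows "\<bar>(\<Sum>m | m < n \<and> s dvd n - m. real m ^ r) - real n ^ Suc r / (real s * real (Suc r))\<bar>
    \<le> real n ^ r"
proof -
  define P where "P n = (\<Sum>m | m < n \<and> s dvd n - m. real m ^ r)" for n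
  define K where "K = real s * real (Suc r)"
  have K: "0 < K"
    using assms by (simp add: K_def)
  have "real n ^ Suc r - K * real n ^ r \<le> K * P n \<and> K * P n \<le> real n ^ Suc r"
  proof (induction n rule: less_induct)
    case (less n)
    show ?case
    proof (cases "n < s")
      case True
      \<comment> \<open>The sum is empty here, so the lower bound amounts to
        \<open>n <= K\<close>.\<close>
      then have "real n \<le> K"
        unfolding K_def using mult_mono[of "real n" "real s" 1 "real (Suc r)"] by simp
      then show ?thesis
        using True by (simp add: P_def sum_progression_less mult_right_mono)
    next
      case False
      then have n: "real n = real (n - s) + real s"
        by simp
      have P: "P n = real (n - s) ^ r + P (n - s)"
        unfolding P_def using assms False by (intro sum_progression_rec) simp_all
      have "real (n - s) ^ Suc r - K * real (n - s) ^ r \<le> K * P (n - s)"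
        "K * P (n - s) \<le> real (n - s) ^ Suc r"
        using less[of "n - s"] assms False by simp_all
      moreover have "K * x ^ r \<le> (x + real s) ^ Suc r - x ^ Suc r"
        "(x + real s) ^ Suc r - x ^ Suc r \<le> K * (x + real s) ^ r" if "0 \<le> x" for x
        using power_Suc_diff_bounds[of x "x + real s" r] that
        by (simp_all add: K_def mult_ac del: power_Suc of_nat_Suc)
      note this[of "real (n - s)", folded n, OF of_nat_0_le_iff]
      ultimately show ?thesis
        unfolding P distrib_left by linarith
    qed
  qed
  then have "\<bar>P n - real n ^ Suc r / K\<bar> \<le> real n ^ r"
    using K by (auto simp: abs_le_iff field_simps)
  then show ?thesis
    by (simp only: P_def K_def)
qed

lemma sum_progression_le:
  fixes f :: "nat \<Rightarrow> real"
  assumes "\<And>m. m < n \<Longrightarrow> f m \<le> B" "0 \<le> B"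
  shows "(\<Sum>m | m < n \<and> s dvd n - m. f m) \<le> real n * B"
proof -
  have "card {m. m < n \<and> s dvd n - m} \<le> card {..<n}"
    by (rule card_mono) auto
  then have "real (card {m. m < n \<and> s dvd n - m}) * B \<le> real n * B"
    using assms by (intro mult_right_mono) simp_all
  moreover have "(\<Sum>m | m < n \<and> s dvd n - m. f m) \<le> real (card {m. m < n \<and> s dvd n - m}) * B"
    using assms by (intro sum_bounded_above) auto
  ultimately show ?thesis
    by linarith
qed

text \<open>The cost of replacing \<open>ln m\<close> by \<open>ln n\<close>: ln (n / m) is at most
  n / m, which trades one factor \<open>m\<close> for \<open>n\<close>. At \<open>m = 0\<close> the
  power vanishes because \<open>r > 0\<close>.\<close>

lemma power_mult_ln_diff_bounds:
  assumes "m < n" "0 < r"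
  shows "0 \<le> real m ^ r * (ln (real n) - ln (real m))"
    and "real m ^ r * (ln (real n) - ln (real m)) \<le> real n ^ r"
proof -
  show "0 \<le> real m ^ r * (ln (real n) - ln (real m))"
    using assms by (cases "m = 0") (simp_all add: mult_nonneg_nonneg)
  show "real m ^ r * (ln (real n) - ln (real m)) \<le> real n ^ r"
  proof (cases "m = 0")
    case False
    obtain q where r: "r = Suc q"
      using assms by (cases r) auto
    have "ln (real n) - ln (real m) = ln (real n / real m)"
      using False assms by (simp add: ln_div)
    also have "\<dots> \<le> real n / real m - 1"
      using False assms by (intro ln_le_minus_one) simp
    also have "\<dots> \<le> real n / real m"
      by simp
    finally have "real m ^ r * (ln (real n) - ln (real m)) \<le> real m ^ r * (real n / real m)"
      by (rule mult_left_mono) simp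
    also have "\<dots> = real m ^ q * real n"
      using False by (simp add: r)
    also have "\<dots> \<le> real n ^ q * real n"
      using assms by (intro mult_right_mono power_mono) simp_all
    finally show ?thesis
      by (simp add: r mult.commute)
  qed (use assms in \<open>simp add: zero_power\<close>)
qed

lemma ln_real_le: "ln (real n) \<le> real n"
  using ln_le_minus_one[of "real n"] by (cases "n = 0") simp_all

text \<open>Three errors add up: \<open>C\<close> from replacing \<open>a\<close> by its main term,
  |c| from replacing \<open>ln m\<close> by \<open>ln n\<close>, and |c| from the power sum, whose
  error is multiplied by ln n <= n.\<close>

lemma sum_progression_power_ln:
  assumes s: "0 < s" and r: "0 < r"
    and a: "\<And>n. \<bar>a n - c * real n ^ r * ln (real n)\<bar> \<le> C * real n ^ r"
  shows "\<bar>(\<Sum>m | m < n \<and> s dvd n - m. a m)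
      - c / (real s * real (Suc r)) * real n ^ Suc r * ln (real n)\<bar>
    \<le> (C + 2 * \<bar>c\<bar>) * real n ^ Suc r"
proof -
  let ?A = "{m. m < n \<and> s dvd n - m}"
  let ?P = "\<Sum>m\<in>?A. real m ^ r"
  let ?K = "real s * real (Suc r)"
  \<comment> \<open>At \<open>n = 1\<close> the logarithm vanishes, so \<open>C\<close> bounds an
    absolute value.\<close>
  have C: "0 \<le> C"
    using a[of 1] by simp
  have le: "C * real m ^ r \<le> C * real n ^ r" if "m < n" for m
    using that C by (intro mult_left_mono power_mono) simp_all
  have "\<bar>(\<Sum>m\<in>?A. a m) - (\<Sum>m\<in>?A. c * real m ^ r * ln (real m))\<bar>
      \<le> (\<Sum>m\<in>?A. \<bar>a m - c * real m ^ r * ln (real m)\<bar>)"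
    unfolding sum_subtractf [symmetric] by (rule sum_abs)
  also have "\<dots> \<le> real n * (C * real n ^ r)"
    using order_trans[OF a le] C by (intro sum_progression_le) simp_all
  finally have 1: "\<bar>(\<Sum>m\<in>?A. a m) - (\<Sum>m\<in>?A. c * real m ^ r * ln (real m))\<bar>
      \<le> C * real n ^ Suc r"
    by (simp add: mult_ac)
  let ?D = "\<Sum>m\<in>?A. real m ^ r * (ln (real n) - ln (real m))"
  have "?D \<le> real n * real n ^ r"
    using power_mult_ln_diff_bounds(2)[OF _ r] by (intro sum_progression_le) simp_all
  moreover have "0 \<le> ?D"
    using power_mult_ln_diff_bounds(1)[OF _ r] by (intro sum_nonneg) simp
  ultimately have "\<bar>c\<bar> * \<bar>?D\<bar> \<le> \<bar>c\<bar> * real n ^ Suc r"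
    by (intro mult_left_mono) simp_all
  moreover have "(\<Sum>m\<in>?A. c * real m ^ r * ln (real m)) - c * (ln (real n) * ?P) = - (c * ?D)"
    by (simp add: algebra_simps sum_subtractf sum_distrib_left)
  ultimately have 2: "\<bar>(\<Sum>m\<in>?A. c * real m ^ r * ln (real m)) - c * (ln (real n) * ?P)\<bar>
      \<le> \<bar>c\<bar> * real n ^ Suc r"
    by (simp add: abs_mult)
  have ln: "0 \<le> ln (real n)"
    by (cases "n = 0") simp_all
  have "ln (real n) * \<bar>?P - real n ^ Suc r / ?K\<bar> \<le> real n * real n ^ r"
    using sum_powers_progression[OF s] ln ln_real_le by (intro mult_mono) simp_all
  then have "\<bar>c\<bar> * (ln (real n) * \<bar>?P - real n ^ Suc r / ?K\<bar>) \<le> \<bar>c\<bar> * real n ^ Suc r"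
    by (intro mult_left_mono) simp_all
  moreover have "c * (ln (real n) * ?P) - c / ?K * real n ^ Suc r * ln (real n) =
      c * (ln (real n) * (?P - real n ^ Suc r / ?K))"
    by (simp add: algebra_simps)
  ultimately have 3: "\<bar>c * (ln (real n) * ?P) - c / ?K * real n ^ Suc r * ln (real n)\<bar>
      \<le> \<bar>c\<bar> * real n ^ Suc r"
    using ln by (simp add: abs_mult)
  have triangle: "\<bar>u - x\<bar> \<le> p + q + q'"
    if "\<bar>u - v\<bar> \<le> p" "\<bar>v - w\<bar> \<le> q" "\<bar>w - x\<bar> \<le> q'" for u v w x p q q' :: real
    using that by linarith
  have "\<bar>(\<Sum>m\<in>?A. a m) - c / ?K * real n ^ Suc r * ln (real n)\<bar>
      \<le> C * real n ^ Suc r + \<bar>c\<bar> * real n ^ Suc r + \<bar>c\<bar> * real n ^ Suc r"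
    by (rule triangle[OF 1 2 3])
  then show ?thesis
    by (simp only: distrib_right mult_2 add.assoc)
qed

section \<open>Dirichlet's divisor estimate\<close>

lemma harm_diff_ln_bounds:
  assumes "0 < n"
  shows "ln (real n) \<le> harm n" and "harm n \<le> ln (real n) + 1"
proof -
  have "ln (real n) \<le> ln (real n + 1)"
    using assms by simp
  then show "ln (real n) \<le> harm n"
    using ln_le_harm[of n] by linarith
  obtain m where "n = Suc m"
    using assms by (cases n) auto
  then show "harm n \<le> ln (real n) + 1"
    using decseqD[OF decseq_harm_diff_ln, of 0 m] by (simp add: harm_Suc harm_def)
qed

text \<open>An error of at most 1 comes from the vanishing constant coefficient of
  \<open>qgeom 1\<close>, another from counting the terms of the progression.\<close>

lemma nth_qgeom_mult_qgeom_1: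
  assumes "0 < r"
  shows "\<bar>(qgeom r * qgeom 1) $ n - real n / real r\<bar> \<le> 2"
proof -
  let ?A = "{m. m < n \<and> r dvd n - m}"
  have "(\<Sum>m\<in>?A. 1 - qgeom 1 $ m) = (\<Sum>m\<in>?A. if m = 0 then 1 else 0)"
    by (rule sum.cong) (auto simp: qgeom_def)
  then have "(\<Sum>m\<in>?A. 1 - qgeom 1 $ m) \<le> 1"
    by simp
  moreover have "0 \<le> (\<Sum>m\<in>?A. 1 - qgeom 1 $ m)"
    by (rule sum_nonneg) (simp add: qgeom_def)
  moreover have "\<bar>(\<Sum>m\<in>?A. 1) - real n / real r\<bar> \<le> 1"
    using sum_powers_progression[OF assms, where n = n and r = 0] by simp
  ultimately show ?thesis
    unfolding nth_qgeom_mult sum_subtractf by linarith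
qed

text \<open>The coefficient sums the divisor function below \<open>n\<close>. Expanding the Lambert
  series gives about \<open>n / r\<close> for each \<open>r <= n\<close>, with total error
  \<open>2 * n\<close>; passing from the harmonic number to \<open>ln n\<close> costs another
  \<open>n\<close>.\<close>

lemma nth_qgeom_1_mult_divisor_fps:
  "\<bar>(qgeom 1 * divisor_fps) $ n - real n * ln (real n)\<bar> \<le> 3 * real n"
proof (cases "n = 0")
  case False
  have dvd: "fps_X ^ Suc n dvd qgeom 1 * ((\<Sum>r=1..n. qgeom r) - divisor_fps)"
    using divisor_fps_eq_sum_qgeom by (rule dvd_mult)
  then have "(qgeom 1 * divisor_fps) $ n = (qgeom 1 * (\<Sum>r=1..n. qgeom r)) $ n"
    unfolding fps_X_power_dvd_iff by (auto simp: right_diff_distrib dest: spec[of _ n])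
  also have "\<dots> = (\<Sum>r=1..n. (qgeom r * qgeom 1) $ n)"
    by (simp add: sum_distrib_left fps_sum_nth mult.commute)
  finally have eq: "(qgeom 1 * divisor_fps) $ n - real n * harm n =
      (\<Sum>r=1..n. (qgeom r * qgeom 1) $ n - real n / real r)"
    by (simp add: sum_subtractf harm_def sum_distrib_left divide_inverse)
  have "\<bar>\<Sum>r=1..n. (qgeom r * qgeom 1) $ n - real n / real r\<bar> \<le> (\<Sum>r=1..n. 2)"
    by (rule order_trans[OF sum_abs sum_mono]) (use nth_qgeom_mult_qgeom_1 in auto)
  then have "\<bar>(qgeom 1 * divisor_fps) $ n - real n * harm n\<bar> \<le> 2 * real n"
    unfolding eq by simp
  moreover have "real n * ln (real n) \<le> real n * harm n"
    "real n * harm n \<le> real n * (ln (real n) + 1)"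
    using False by (intro mult_left_mono harm_diff_ln_bounds; simp)+
  ultimately show ?thesis
    unfolding distrib_left by linarith
qed (simp add: qgeom_def)

text \<open>The factor \<open>qgeom s\<close> with \<open>s = j + 2\<close> divides the leading
  coefficient by \<open>s\<close> for the spacing of the progression and by \<open>s\<close> again
  for the exponent, which rises to \<open>s\<close>; hence the squared factorial.\<close>

lemma nth_qelem_inf_mult_divisor_fps:
  "\<exists>C. \<forall>n. \<bar>(qelem_inf (Suc j) * divisor_fps) $ n
      - 1 / (fact (Suc j))\<^sup>2 * real n ^ Suc j * ln (real n)\<bar> \<le> C * real n ^ Suc j"
proof (induction j)
  case 0
  show ?case
    using nth_qgeom_1_mult_divisor_fps
    by (intro exI[of _ 3]) (simp add: qelem_inf_Suc qelem_inf_0)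
next
  case (Suc j)
  then obtain C where C: "\<And>n. \<bar>(qelem_inf (Suc j) * divisor_fps) $ n
      - 1 / (fact (Suc j))\<^sup>2 * real n ^ Suc j * ln (real n)\<bar> \<le> C * real n ^ Suc j"
    by blast
  have "1 / (fact (Suc (Suc j)))\<^sup>2 =
      (1 / (fact (Suc j))\<^sup>2 / (real (Suc (Suc j)) * real (Suc (Suc j))) :: real)"
    by (simp only: fact_Suc[of "Suc j"] power2_eq_square divide_divide_eq_left mult_ac)
  then show ?case
    using sum_progression_power_ln[OF zero_less_Suc zero_less_Suc C, of _ "Suc j"]
    unfolding qelem_inf_Suc[of "Suc j"] mult.assoc[of "qgeom _"] nth_qgeom_mult by auto
qed

section \<open>Induction on k\<close>

lemma nth_qelem_inf_bounds: "0 \<le> qelem_inf j $ n \<and> qelem_inf j $ n \<le> real n ^ j"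
proof (induction j arbitrary: n)
  case 0
  show ?case
    by (simp add: qelem_inf_0)
next
  case (Suc j)
  have "qelem_inf j $ m \<le> real n ^ j" if "m < n" for m
    using conjunct2[OF Suc, of m] power_mono[of "real m" "real n" j] that by linarith
  then show ?case
    unfolding qelem_inf_Suc nth_qgeom_mult
    using Suc by (auto intro!: sum_nonneg sum_progression_le)
qed

text \<open>In \<open>FFW_recurrence\<close> only \<open>qelem_inf (Suc j) * divisor_fps\<close>
  reaches the main order. The previous \<open>FFW\<close> value, the multiple of
  \<open>qelem_inf (Suc j)\<close> and the error of the divisor term contribute \<open>B\<close>,
  \<open>Suc j\<close> and \<open>C\<close>.\<close>

lemma FFW_Suc_Suc_asymp:
  assumes B: "\<And>n. \<bar>real_of_int (FFW (Suc j) n)\<bar> \<le> B * real n ^ Suc j"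
  shows "\<exists>C. \<forall>n. \<bar>real_of_int (FFW (Suc (Suc j)) n)
      - (-1) ^ j / (fact (Suc j))\<^sup>2 * real n ^ Suc j * ln (real n)\<bar> \<le> C * real n ^ Suc j"
proof -
  let ?e = "qelem_inf (Suc j)" and ?c = "1 / (fact (Suc j))\<^sup>2 :: real"
  obtain C where C: "\<And>n. \<bar>(?e * divisor_fps) $ n - ?c * real n ^ Suc j * ln (real n)\<bar>
      \<le> C * real n ^ Suc j"
    using nth_qelem_inf_mult_divisor_fps by blast
  have "\<bar>real_of_int (FFW (Suc (Suc j)) n) - (-1) ^ j * (?c * real n ^ Suc j * ln (real n))\<bar>
      \<le> (B + real (Suc j) + C) * real n ^ Suc j" for n
  proof -
    let ?x = "(?e * divisor_fps) $ n - ?c * real n ^ Suc j * ln (real n)"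
    have "(?e * (of_nat (Suc j) + divisor_fps)) $ n =
        real (Suc j) * ?e $ n + (?e * divisor_fps) $ n"
      by (simp add: distrib_left mult.commute[of ?e] flip: fps_of_nat)
    then have eq: "real_of_int (FFW (Suc (Suc j)) n) - (-1) ^ j * (?c * real n ^ Suc j * ln (real n))
        = real_of_int (FFW (Suc j) n) + (-1) ^ j * (real (Suc j) * ?e $ n) + (-1) ^ j * ?x"
      unfolding FFW_recurrence by (simp add: algebra_simps)
    have "real (Suc j) * ?e $ n \<le> real (Suc j) * real n ^ Suc j" "0 \<le> real (Suc j) * ?e $ n"
      using nth_qelem_inf_bounds[of "Suc j" n] by (auto intro!: mult_left_mono simp del: power_Suc)
    moreover have "\<bar>(-1) ^ j * z\<bar> = \<bar>z\<bar>" for z :: real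
      by (simp add: abs_mult)
    ultimately have "\<bar>(-1) ^ j * (real (Suc j) * ?e $ n)\<bar> \<le> real (Suc j) * real n ^ Suc j"
      "\<bar>(-1) ^ j * ?x\<bar> \<le> C * real n ^ Suc j"
      using C[of n] by simp_all
    then show ?thesis
      unfolding eq distrib_right using B[of n] by linarith
  qed
  then show ?thesis
    by (auto simp: mult.assoc)
qed

text \<open>Since \<open>ln n <= n\<close>, the asymptotic estimate for one index yields this cruder
  bound, which is all that the estimate for the next index needs.\<close>

lemma FFW_Suc_bound: "\<exists>B. \<forall>n. \<bar>real_of_int (FFW (Suc j) n)\<bar> \<le> B * real n ^ Suc j"
proof (induction j)
  case 0
  have "card {r \<in> {1..n}. r dvd n} \<le> card {1..n}" for n :: nat
    by (rule card_mono) auto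
  then have "\<bar>real_of_int (FFW (Suc 0) n)\<bar> \<le> 1 * real n ^ Suc 0" for n
    using FFW_1[of n] by (simp add: divisor_fps_def)
  then show ?case
    by blast
next
  case (Suc j)
  let ?c = "1 / (fact (Suc j))\<^sup>2 :: real"
  obtain C where C: "\<And>n. \<bar>real_of_int (FFW (Suc (Suc j)) n)
      - (-1) ^ j / (fact (Suc j))\<^sup>2 * real n ^ Suc j * ln (real n)\<bar> \<le> C * real n ^ Suc j"
    using Suc FFW_Suc_Suc_asymp by blast
  have "0 \<le> C"
    using C[of 1] by simp
  have "\<bar>real_of_int (FFW (Suc (Suc j)) n)\<bar> \<le> (C + ?c) * real n ^ Suc (Suc j)" for n
  proof -
    have ln: "0 \<le> ln (real n)"
      by (cases "n = 0") simp_all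
    have "real n ^ Suc j * ln (real n) \<le> real n ^ Suc j * real n"
      using ln_real_le by (intro mult_left_mono) simp_all
    then have "?c * (real n ^ Suc j * ln (real n)) \<le> ?c * real n ^ Suc (Suc j)"
      by (intro mult_left_mono) (simp_all add: mult_ac)
    moreover have "\<bar>(-1) ^ j / (fact (Suc j))\<^sup>2 * real n ^ Suc j * ln (real n)\<bar> =
        ?c * (real n ^ Suc j * ln (real n))"
      using ln by (simp add: abs_mult)
    moreover have "real n ^ Suc j \<le> real n ^ Suc (Suc j)"
      by (cases "n = 0") (simp_all add: power_increasing del: power_Suc)
    then have "C * real n ^ Suc j \<le> C * real n ^ Suc (Suc j)"
      using \<open>0 \<le> C\<close> by (rule mult_left_mono)
    ultimately show ?thesis
      unfolding distrib_right using C[of n] by linarith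
  qed
  then show ?case
    by blast
qed

theorem theorem1p3:
  fixes k :: nat
  assumes "k > 1"
  shows "(\<lambda>n::nat. real_of_int (FFW k n)) \<sim>[at_top]
         (\<lambda>n. (-1) ^ k / (fact (k - 1))\<^sup>2 * real n ^ (k - 1) * ln (real n))"
proof -
  obtain j where k: "k = Suc (Suc j)"
    using assms by (intro that[of "k - 2"]) simp
  let ?c = "(-1) ^ j / (fact (Suc j))\<^sup>2 :: real"
  obtain B where "\<And>n. \<bar>real_of_int (FFW (Suc j) n)\<bar> \<le> B * real n ^ Suc j"
    using FFW_Suc_bound by blast
  from FFW_Suc_Suc_asymp[OF this]
  obtain C where C: "\<And>n. \<bar>real_of_int (FFW k n) - ?c * real n ^ Suc j * ln (real n)\<bar>
      \<le> C * real n ^ Suc j"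
    unfolding k by blast
  have "(\<lambda>n. real_of_int (FFW k n) - ?c * real n ^ Suc j * ln (real n)) \<in> O(\<lambda>n. real n ^ Suc j)"
    using C by (intro bigoI[of _ C] always_eventually) (simp add: abs_mult)
  also have "(\<lambda>n. real n ^ Suc j) \<in> o(\<lambda>n. ?c * real n ^ Suc j * ln (real n))"
  proof -
    have "(\<lambda>n. 1 :: real) \<in> o(\<lambda>n. ln (real n))"
      by real_asymp
    from landau_o.big_small_mult[OF landau_o.big_refl[of "\<lambda>n. ?c * real n ^ Suc j"] this]
    show ?thesis
      by simp
  qed
  finally have "(\<lambda>n. real_of_int (FFW k n)) \<sim>[at_top] (\<lambda>n. ?c * real n ^ Suc j * ln (real n))"
    by (simp add: asymp_equiv_altdef)
  then show ?thesis
    by (simp add: k)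
qed

end
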